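(* Let $\lambda:\mathbb{N}\to[0,\infty)$ be a multiplicative function such that: (a) there exists a set $S$ of primes for which $P_x:=\prod_{p\in S,\,p\le x}p\ll_\alpha x^\alpha$ for any $\alpha>0$; (b) there exist $\delta,B>0$ for which $\delta\le\lambda(p)\le B$ for primes $p\notin S$ and $\lambda(p)\le\delta$ for $p\in S$; and (c) $\sum_{p,\,k\ge2}\frac{\lambda(p^k)}{p^k}\ll_B1$. Then for $x$ sufficiently large, $$\sum_{n\le x}\lambda(n)\gg_B\delta\,\frac{\phi(P_x)}{P_x}\frac{x}{\log x}\sum_{n\le x}\frac{\lambda(n)}{n}\gg_B\delta\,\frac{\phi(P_x)}{P_x}\frac{x}{\log x}\prod_{p\le x}\left(1+\frac{\lambda(p)}{p}\right).$$
   Context: $p$ denotes primes, $\phi$ is Euler's totient function, and subscripts on $\ll,\gg$ indicate parameters on which the implied constants may depend. *)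

theory Defs
  imports "HOL-Number_Theory.Number_Theory" "HOL-Library.Landau_Symbols" "HOL-Analysis.Infinite_Sum"
begin

text \<open>Arithmetic functions live on the positive integers; the value at \<open>0\<close> is irrelevant.\<close>

definition multiplicative :: "(nat \<Rightarrow> real) \<Rightarrow> bool" where
  "multiplicative f \<longleftrightarrow>
     f 1 = 1 \<and> (\<forall>m>0. \<forall>n>0. coprime m n \<longrightarrow> f (m * n) = f m * f n)"

definition primorial_in :: "nat set \<Rightarrow> real \<Rightarrow> nat" where
  "primorial_in S x = (\<Prod>p\<in>{p. p \<in> S \<and> prime p \<and> real p \<le> x}. p)"

end

theory Submission
  imports Defs "HOL-Real_Asymp.Real_Asymp"
begin

text \<open>Write \<open>M(x)\<close> for the sum of \<open>\<lambda>(n) / n\<close> over \<open>n \<le> x\<close> and \<open>\<Pi>(x)\<close> for the product of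
  \<open>1 + \<lambda>(p) / p\<close> over \<open>p \<le> x\<close>. Expanding the Euler product gives \<open>M(x) \<le> e\<^sup>K \<Pi>(x)\<close>. Conversely,
  with \<open>z\<close> a small power of \<open>x\<close>, at least half of the expanded product \<open>\<Pi>(z)\<close> comes from \<open>n \<le> x\<close>,
  and \<open>\<Pi>(x) \<lless> \<Pi>(z)\<close>; hence \<open>M(x) \<ggreater> \<Pi>(x)\<close>, and \<open>M(sqrt x) \<ggreater> \<Pi>(sqrt x) \<ggreater> \<Pi>(x) \<ggreater> M(x)\<close>.
  Finally, splitting \<open>n = m p\<close> in the sum of \<open>\<lambda>(n) ln n\<close> and using Chebyshev's lower bound for the
  primes \<open>p \<le> x / m\<close> outside \<open>S\<close> bounds \<open>ln x\<close> times the sum of \<open>\<lambda>(n)\<close> from below by a constant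
  times \<open>\<delta> x M(sqrt x)\<close>. The factor \<open>\<phi>(P) / P \<le> 1\<close> only weakens the result.\<close>

subsection \<open>Chebyshev and Mertens type bounds\<close>

definition primes_le :: "real \<Rightarrow> nat set" where
  "primes_le x = {p. prime p \<and> real p \<le> x}"

lemma finite_real_le [simp]: "finite {n::nat. real n \<le> x}"
  by (rule finite_subset[of _ "{..nat \<lfloor>x\<rfloor>}"]) (auto simp: le_nat_floor)

lemma finite_primes_le [simp]: "finite (primes_le x)"
  unfolding primes_le_def by (rule finite_subset[OF _ finite_real_le[of x]]) auto

lemma finite_pos_real_le [simp]: "finite {n::nat. 0 < n \<and> real n \<le> x}"
  by (rule finite_subset[OF _ finite_real_le[of x]]) auto

lemma primes_le_prime: "p \<in> primes_le x \<Longrightarrow> prime p"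
  by (simp add: primes_le_def)

text \<open>Passing from n to n + 1 raises \<open>n div d\<close> by one exactly when d divides n +
  1, and the Mangoldt function summed over the divisors of n + 1 is ln (n + 1). Both Chebyshev type
  estimates below start from this identity.\<close>

lemma ln_fact_mangoldt:
  "ln (fact n :: real) = (\<Sum>d\<in>{1..n}. mangoldt d * real (n div d))"
proof (induction n)
  case (Suc n)
  have "(\<Sum>d\<in>{1..Suc n}. mangoldt d * real (Suc n div d))
      = (\<Sum>d\<in>{1..Suc n}. mangoldt d * real (n div d) + (if d dvd Suc n then mangoldt d else 0))"
    by (intro sum.cong refl) (auto simp: div_Suc dvd_eq_mod_eq_0 algebra_simps)
  also have "\<dots> = (\<Sum>d\<in>{1..Suc n}. mangoldt d * real (n div d))
                + (\<Sum>d\<in>{1..Suc n}. if d dvd Suc n then mangoldt d else 0)"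
    by (rule sum.distrib)
  also have "(\<Sum>d\<in>{1..Suc n}. mangoldt d * real (n div d)) = ln (fact n)"
    by (simp add: Suc.IH)
  also have "(\<Sum>d\<in>{1..Suc n}. if d dvd Suc n then mangoldt d else 0)
      = (\<Sum>d | d dvd Suc n. mangoldt d :: real)"
    by (intro sum.mono_neutral_cong_right) (auto simp: Suc_le_eq dest: dvd_imp_le intro!: Nat.gr0I)
  also have "\<dots> = ln (real (Suc n))"
    using mangoldt_sum[of "Suc n", where ?'a = real] by simp
  finally show ?case
    by (simp add: ln_mult del: of_nat_Suc)
qed simp

text \<open>Mertens' upper bound with a crude constant: only the primes are kept in the Mangoldt
  expansion of ln n!, where n is the floor of x, and n! is at most n^n. The factor 2 is the cost of
  replacing the floor of n / p by n / (2 p).\<close>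

lemma sum_ln_div_primes_le:
  assumes "x \<ge> 1"
  shows "(\<Sum>p\<in>primes_le x. ln (real p) / real p) \<le> 2 * ln x"
proof -
  define n where "n = nat \<lfloor>x\<rfloor>"
  have n: "n > 0" "real n \<le> x"
    using assms by (auto simp: n_def)
  have mem: "1 \<le> p \<and> p \<le> n" if "p \<in> primes_le x" for p
    using that prime_gt_0_nat[of p] by (auto simp: primes_le_def n_def le_nat_floor)
  have "(real n / 2) * (\<Sum>p\<in>primes_le x. ln (real p) / real p)
      = (\<Sum>p\<in>primes_le x. ln (real p) * (real n / (2 * real p)))"
    by (simp add: sum_distrib_left field_simps)
  also have "\<dots> \<le> (\<Sum>p\<in>primes_le x. mangoldt p * real (n div p))"
  proof (rule sum_mono)
    fix p assume p: "p \<in> primes_le x"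
    have "n = p * (n div p) + n mod p" "n mod p < p" "n div p \<ge> 1"
      using mem[OF p] by (auto simp: div_greater_zero_iff Suc_le_eq)
    moreover have "p \<le> p * (n div p)" using \<open>n div p \<ge> 1\<close> by simp
    ultimately have "n \<le> 2 * p * (n div p)" by linarith
    hence "real n \<le> 2 * real p * real (n div p)"
      by (metis of_nat_le_iff of_nat_mult of_nat_numeral)
    hence "real n / (2 * real p) \<le> real (n div p)"
      using mem[OF p] by (simp add: field_simps)
    moreover have "ln (real p) \<ge> 0" using mem[OF p] by simp
    ultimately show "ln (real p) * (real n / (2 * real p)) \<le> mangoldt p * real (n div p)"
      unfolding mangoldt_prime[OF primes_le_prime[OF p]] of_real_eq_id id_apply
      by (intro mult_left_mono)
  qed
  also have "\<dots> \<le> (\<Sum>d\<in>{1..n}. mangoldt d * real (n div d))"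
    using mem by (intro sum_mono2) (auto simp: mangoldt_nonneg)
  also have "\<dots> = ln (fact n)" by (simp add: ln_fact_mangoldt)
  also have "\<dots> \<le> ln (real n ^ n)"
    using fact_le_power[of n] n by (subst ln_le_cancel_iff) (auto simp: fact_le_power)
  also have "\<dots> = real n * ln (real n)" using n by (simp add: ln_realpow)
  finally have "(\<Sum>p\<in>primes_le x. ln (real p) / real p) \<le> 2 * ln (real n)"
    using n by (simp add: field_simps)
  also have "\<dots> \<le> 2 * ln x" using n by simp
  finally show ?thesis .
qed

text \<open>Beyond z each ln p is at least ln z, so the previous bound may be divided by ln z. When
  z is a fixed power of x the result is a constant, which makes Euler products at z and at x
  comparable.\<close>

lemma sum_inverse_primes_between:
  assumes "z > 1" "z \<le> x"
  shows "(\<Sum>p\<in>primes_le x - primes_le z. 1 / real p) \<le> 2 * ln x / ln z"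
proof -
  have "ln z * (\<Sum>p\<in>primes_le x - primes_le z. 1 / real p)
      \<le> (\<Sum>p\<in>primes_le x - primes_le z. ln (real p) / real p)"
    unfolding sum_distrib_left using assms
    by (intro sum_mono) (auto simp: primes_le_def divide_right_mono)
  also have "\<dots> \<le> (\<Sum>p\<in>primes_le x. ln (real p) / real p)"
    by (intro sum_mono2) (auto simp: primes_le_def dest: prime_gt_0_nat)
  also have "\<dots> \<le> 2 * ln x" using assms by (intro sum_ln_div_primes_le) auto
  finally show ?thesis using assms by (simp add: field_simps)
qed

section \<open>Chebyshev's lower bound for the sum of ln p\<close>

lemma card_higher_primepows_le:
  fixes N :: nat
  assumes "N > 0"
  shows "real (card {d\<in>{1..N}. primepow d \<and> \<not> prime d}) \<le> (sqrt (real N) + 1) * (log 2 (real N) + 1)"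
proof -
  define s where "s = nat \<lfloor>sqrt (real N)\<rfloor>"
  define L where "L = nat \<lfloor>log 2 (real N)\<rfloor>"
  \<comment> \<open>A proper prime power p^k has k at least 2, which forces p to be at most sqrt N,
    while p at least 2 bounds k by the binary logarithm of N.\<close>
  have "{d\<in>{1..N}. primepow d \<and> \<not> prime d} \<subseteq> (\<lambda>(p, k). p ^ k) ` ({..s} \<times> {..L})"
  proof safe
    fix d assume d: "d \<in> {1..N}" "primepow d" "\<not> prime d"
    then obtain p k where pk: "prime p" "k > 0" "d = p ^ k"
      by (auto simp: primepow_def)
    with d have k: "k \<ge> 2" by (cases "k = 1") auto
    have p2: "p \<ge> 2" using pk by (simp add: prime_ge_2_nat)
    have "p ^ 2 \<le> p ^ k" using k p2 by (intro power_increasing) auto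
    hence "p ^ 2 \<le> N" using d pk by simp
    hence "real p \<le> sqrt (real N)"
      by (intro real_le_rsqrt) (metis of_nat_le_iff of_nat_power)
    hence 1: "p \<le> s" by (simp add: s_def le_nat_floor)
    have "2 ^ k \<le> p ^ k" using p2 by (intro power_mono) auto
    also have "p ^ k \<le> N" using d pk by simp
    finally have "2 ^ k \<le> real N" by (metis of_nat_le_iff of_nat_numeral of_nat_power)
    hence "real k \<le> log 2 (real N)"
      using assms by (simp add: le_log_iff powr_realpow)
    hence 2: "k \<le> L" by (simp add: L_def le_nat_floor)
    show "d \<in> (\<lambda>(p, k). p ^ k) ` ({..s} \<times> {..L})"
      using 1 2 pk by auto
  qed
  hence "card {d\<in>{1..N}. primepow d \<and> \<not> prime d} \<le> card ((\<lambda>(p, k). p ^ k) ` ({..s} \<times> {..L}))"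
    by (intro card_mono) auto
  also have "\<dots> \<le> card ({..s} \<times> {..L})" by (rule card_image_le) auto
  also have "\<dots> = (s + 1) * (L + 1)" by (simp add: card_cartesian_product)
  finally have "real (card {d\<in>{1..N}. primepow d \<and> \<not> prime d}) \<le> real ((s + 1) * (L + 1))"
    by (simp only: of_nat_le_iff)
  also have "\<dots> = (real s + 1) * (real L + 1)" by (simp add: algebra_simps)
  also have "\<dots> \<le> (sqrt (real N) + 1) * (log 2 (real N) + 1)"
    using assms by (intro mult_mono add_mono) (auto simp: s_def L_def)
  finally show ?thesis .
qed

text \<open>Chebyshev's argument: the central binomial coefficient is at least 4^n / (2 n), and its
  logarithm is a combination of Mangoldt values with weights at most 1. Proper prime powers are
  moved into the error term, each counted with weight ln N.\<close>

lemma sum_ln_primes_even_ge: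
  assumes "n > 0"
  defines "N \<equiv> real (2 * n)"
  shows "(\<Sum>p\<in>primes_le N. ln (real p))
       \<ge> real n * ln 4 - ln N - (sqrt N + 1) * (log 2 N + 1) * ln N"
proof -
  let ?N = "2 * n"
  have "real n * ln 4 - ln N = ln (4 ^ n / N)"
  proof -
    have "N > 0" using assms(1) by (simp add: N_def)
    hence "ln (4 ^ n / N) = ln (4 ^ n) - ln N" by (simp add: ln_div)
    thus ?thesis using ln_realpow[of 4 n] by linarith
  qed
  also have "\<dots> \<le> ln (real (?N choose n))"
    using assms(1) central_binomial_lower_bound[of n] by (subst ln_le_cancel_iff) (auto simp: N_def)
  also have "real (?N choose n) = fact ?N / (fact n * fact n)"
    by (simp add: binomial_fact)
  also have "ln \<dots> = ln (fact ?N) - 2 * ln (fact n)"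
    by (simp add: ln_div ln_mult)
  also have "ln (fact n :: real) = (\<Sum>d\<in>{1..?N}. mangoldt d * real (n div d))"
    unfolding ln_fact_mangoldt by (intro sum.mono_neutral_left) auto
  also have "ln (fact ?N :: real) - 2 * \<dots> = (\<Sum>d\<in>{1..?N}. mangoldt d * (real (?N div d) - 2 * real (n div d)))"
    unfolding ln_fact_mangoldt sum_distrib_left sum_subtractf[symmetric]
    by (intro sum.cong refl) (simp add: algebra_simps)
  \<comment> \<open>The weight is an integer strictly below 2, hence at most 1.\<close>
  also have "\<dots> \<le> (\<Sum>d\<in>{1..?N}. mangoldt d * 1)"
  proof (intro sum_mono mult_left_mono)
    fix d assume "d \<in> {1..?N}"
    hence "n mod d < d" "n = d * (n div d) + n mod d" by auto
    hence "n < d + d * (n div d)" by linarith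
    hence "?N < (2 * (n div d) + 2) * d" by (simp add: algebra_simps)
    hence "?N div d < 2 * (n div d) + 2" by (rule less_mult_imp_div_less)
    thus "real (?N div d) - 2 * real (n div d) \<le> 1" by linarith
  qed (simp add: mangoldt_nonneg)
  also have "\<dots> = (\<Sum>d\<in>primes_le N \<union> {d\<in>{1..?N}. primepow d \<and> \<not> prime d}. mangoldt d)"
    by (intro sum.mono_neutral_cong_right)
       (auto simp: primes_le_def N_def mangoldt_def Suc_le_eq dest: prime_gt_0_nat)
  also have "\<dots> = (\<Sum>d\<in>primes_le N. mangoldt d) + (\<Sum>d\<in>{d\<in>{1..?N}. primepow d \<and> \<not> prime d}. mangoldt d)"
    by (intro sum.union_disjoint) (auto simp: primes_le_def)
  also have "(\<Sum>d\<in>primes_le N. mangoldt d) = (\<Sum>p\<in>primes_le N. ln (real p))"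
    by (intro sum.cong) (auto simp: primes_le_def)
  also have "(\<Sum>d\<in>{d\<in>{1..?N}. primepow d \<and> \<not> prime d}. mangoldt d)
      \<le> real (card {d\<in>{1..?N}. primepow d \<and> \<not> prime d}) * ln N"
  proof (rule sum_bounded_above)
    fix d assume "d \<in> {d\<in>{1..?N}. primepow d \<and> \<not> prime d}"
    hence "mangoldt d \<le> ln (real d)" "ln (real d) \<le> ln N"
      by (auto intro!: mangoldt_le simp: N_def)
    thus "mangoldt d \<le> ln N" by linarith
  qed
  also have "\<dots> \<le> (sqrt N + 1) * (log 2 N + 1) * ln N"
    using assms(1) card_higher_primepows_le[of ?N] unfolding N_def by (intro mult_right_mono) auto
  finally show ?thesis by simp
qed

lemma eventually_sum_ln_primes_ge:
  "\<forall>\<^sub>F x in at_top. (\<Sum>p\<in>primes_le x. ln (real p)) \<ge> x / 2"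
proof -
  \<comment> \<open>The main term is about (x / 2) ln 4, so a bound for ln 4 strictly above 1 leaves
    linear room for the error terms. Here ln 4 = ln 3 - ln (3 / 4) is at least 1 + 1 / 4.\<close>
  have ln4: "ln 4 \<ge> (5 / 4 :: real)"
  proof -
    have "ln 3 \<ge> (1 :: real)" using exp_le by (subst ln_ge_iff) auto
    moreover have "ln (3 / 4 :: real) \<le> 3 / 4 - 1" by (rule ln_le_minus_one) simp
    moreover have "ln (3 / 4 :: real) = ln 3 - ln 4" by (simp add: ln_div)
    ultimately show ?thesis by simp
  qed
  have "\<forall>\<^sub>F x::real in at_top. (x / 2 - 1) * (5 / 4) - ln x - (sqrt x + 1) * (log 2 x + 1) * ln x \<ge> x / 2"
    by real_asymp
  with eventually_ge_at_top[of 4] show ?thesis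
  proof eventually_elim
    case (elim x)
    define n where "n = nat \<lfloor>x / 2\<rfloor>"
    have n: "n > 0" "x / 2 - 1 \<le> real n" "real (2 * n) \<le> x" using elim by (auto simp: n_def) linarith
    have "x / 2 \<le> (x / 2 - 1) * (5 / 4) - ln x - (sqrt x + 1) * (log 2 x + 1) * ln x"
      using elim by simp
    also have "\<dots> \<le> real n * ln 4 - ln (real (2 * n))
         - (sqrt (real (2 * n)) + 1) * (log 2 (real (2 * n)) + 1) * ln (real (2 * n))"
      using n elim by (intro diff_mono mult_mono add_mono) (use ln4 in auto)
    also have "\<dots> \<le> (\<Sum>p\<in>primes_le (real (2 * n)). ln (real p))"
      by (rule sum_ln_primes_even_ge[OF n(1)])
    also have "\<dots> \<le> (\<Sum>p\<in>primes_le x. ln (real p))"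
      using n by (intro sum_mono2) (auto simp: primes_le_def dest: prime_gt_0_nat)
    finally show ?case .
  qed
qed

subsection \<open>Logarithmic averages of multiplicative functions\<close>

text \<open>Each a contributes \<open>f a * l a\<close> times the product of 1 + f over the other
  elements; restoring the missing factor, which is at least 1, gives the bound. With l the logarithm
  on primes, the left side is the total of ln n over the squarefree n in an expanded Euler
  product.\<close>

lemma sum_Pow_weighted_le:
  fixes f l :: "'a \<Rightarrow> real"
  assumes "finite A" "\<And>a. a \<in> A \<Longrightarrow> f a \<ge> 0" "\<And>a. a \<in> A \<Longrightarrow> l a \<ge> 0"
  shows "(\<Sum>T\<in>Pow A. prod f T * sum l T) \<le> (\<Sum>a\<in>A. f a * l a) * (\<Prod>a\<in>A. 1 + f a)"
  using assms
proof (induction A rule: finite_induct)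
  case (insert q A)
  let ?P = "\<Prod>a\<in>A. 1 + f a" and ?W = "\<Sum>T\<in>Pow A. prod f T * sum l T"
  have P: "?P = (\<Sum>T\<in>Pow A. prod f T)"
    using prod_add[OF insert.hyps(1), of f "\<lambda>_. 1"] by (simp add: add.commute)
  have q: "q \<notin> T" "finite T" if "T \<in> Pow A" for T
    using that insert.hyps by (auto intro: finite_subset)
  have "(\<Sum>T\<in>Pow (insert q A). prod f T * sum l T)
      = ?W + (\<Sum>T\<in>insert q ` Pow A. prod f T * sum l T)"
    unfolding Pow_insert using insert.hyps by (intro sum.union_disjoint) auto
  also have "(\<Sum>T\<in>insert q ` Pow A. prod f T * sum l T)
      = (\<Sum>T\<in>Pow A. prod f (insert q T) * sum l (insert q T))"
    using insert.hyps by (subst sum.reindex) (auto simp: inj_on_def)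
  also have "\<dots> = (\<Sum>T\<in>Pow A. f q * (prod f T * sum l T) + f q * l q * prod f T)"
    using q by (intro sum.cong refl) (simp add: algebra_simps)
  also have "\<dots> = f q * ?W + f q * l q * ?P"
    unfolding P by (simp add: sum.distrib sum_distrib_left)
  also have "?W + (f q * ?W + f q * l q * ?P) = (1 + f q) * ?W + f q * l q * ?P"
    by (simp add: algebra_simps)
  also have "\<dots> \<le> (1 + f q) * ((\<Sum>a\<in>A. f a * l a) * ?P) + f q * l q * ((1 + f q) * ?P)"
  proof (intro add_mono mult_left_mono)
    have "?P \<ge> 0" using insert.prems by (intro prod_nonneg) auto
    thus "?P \<le> (1 + f q) * ?P" using insert.prems by (simp add: algebra_simps)
  qed (use insert in auto)
  also have "\<dots> = (\<Sum>a\<in>insert q A. f a * l a) * (\<Prod>a\<in>insert q A. 1 + f a)"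
    using insert.hyps by (simp add: algebra_simps)
  finally show ?case .
qed simp

section \<open>Comparison of sums of multiplicative functions with Euler products\<close>

lemma multiplicative_prod_prime_powers:
  assumes "multiplicative g" "finite A" "\<And>p. p \<in> A \<Longrightarrow> prime p"
  shows "g (\<Prod>p\<in>A. p ^ h p) = (\<Prod>p\<in>A. g (p ^ h p))"
  using assms(2,3)
proof (induction A rule: finite_induct)
  case empty
  thus ?case using assms(1) by (simp add: multiplicative_def)
next
  case (insert q A)
  have "coprime (q ^ h q) (\<Prod>p\<in>A. p ^ h p)"
    using insert by (intro prod_coprime_right) (auto intro!: primes_coprime)
  moreover have "q ^ h q > 0" "(\<Prod>p\<in>A. p ^ h p) > 0"
    by (rule zero_less_power prod_pos; use insert.prems in \<open>auto simp: prime_gt_0_nat\<close>)+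
  ultimately have "g (q ^ h q * (\<Prod>p\<in>A. p ^ h p)) = g (q ^ h q) * g (\<Prod>p\<in>A. p ^ h p)"
    using assms(1) by (simp add: multiplicative_def)
  thus ?case using insert by simp
qed

lemma multiplicative_div_id:
  "multiplicative f \<Longrightarrow> multiplicative (\<lambda>n. f n / real n)"
  by (simp add: multiplicative_def)

text \<open>Expanding the product yields one nonnegative term per choice of exponents. Every n up to
  x occurs, since its prime factors are at most x and its exponents satisfy k < 2^k <= n.\<close>

lemma sum_multiplicative_le_Euler_prod:
  assumes "multiplicative g" "\<And>n. n > 0 \<Longrightarrow> g n \<ge> 0"
  shows "(\<Sum>n\<in>{n. 0 < n \<and> real n \<le> x}. g n)
    \<le> (\<Prod>p\<in>primes_le x. \<Sum>k\<le>nat \<lfloor>x\<rfloor>. g (p ^ k))"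
proof -
  let ?A = "primes_le x" and ?N = "nat \<lfloor>x\<rfloor>"
  define \<Phi> where "\<Phi> h = (\<Prod>p\<in>?A. p ^ h p)" for h :: "nat \<Rightarrow> nat"
  have pos: "\<Phi> h > 0" for h
    unfolding \<Phi>_def by (intro prod_pos) (auto dest: primes_le_prime prime_gt_0_nat)
  have fin: "finite (PiE ?A (\<lambda>_. {..?N}))" by (intro finite_PiE) auto
  have "{n. 0 < n \<and> real n \<le> x} \<subseteq> \<Phi> ` PiE ?A (\<lambda>_. {..?N})"
  proof safe
    fix n :: nat assume n: "0 < n" "real n \<le> x"
    let ?h = "restrict (\<lambda>p. multiplicity p n) ?A"
    have "multiplicity p n \<le> ?N" if "p \<in> ?A" for p
    proof -
      have p: "p \<ge> 2" using that by (auto dest: primes_le_prime prime_ge_2_nat)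
      have "multiplicity p n < 2 ^ multiplicity p n" by (rule less_exp)
      also have "\<dots> \<le> p ^ multiplicity p n" using p by (intro power_mono) auto
      also have "\<dots> \<le> n" using n by (intro dvd_imp_le multiplicity_dvd) auto
      also have "n \<le> ?N" using n by (simp add: le_nat_floor)
      finally show ?thesis by simp
    qed
    hence "?h \<in> PiE ?A (\<lambda>_. {..?N})" by auto
    moreover have "\<Phi> ?h = n"
    proof -
      have "\<Phi> ?h = (\<Prod>p\<in>?A. p ^ multiplicity p n)" by (simp add: \<Phi>_def)
      also have "\<dots> = (\<Prod>p\<in>prime_factors n. p ^ multiplicity p n)"
      proof (rule prod.mono_neutral_right)
        show "prime_factors n \<subseteq> ?A"
        proof
          fix p assume p: "p \<in> prime_factors n"
          hence "p \<le> n" using n by (auto intro: dvd_imp_le)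
          with p n show "p \<in> ?A" by (auto simp: primes_le_def)
        qed
        show "\<forall>p\<in>?A - prime_factors n. p ^ multiplicity p n = 1"
          using n by (auto simp: primes_le_def prime_factors_multiplicity)
      qed auto
      also have "\<dots> = n" using prod_prime_factors[of n] n by simp
      finally show ?thesis .
    qed
    ultimately show "n \<in> \<Phi> ` PiE ?A (\<lambda>_. {..?N})" by (metis image_eqI)
  qed
  hence "(\<Sum>n\<in>{n. 0 < n \<and> real n \<le> x}. g n) \<le> (\<Sum>n\<in>\<Phi> ` PiE ?A (\<lambda>_. {..?N}). g n)"
    using fin pos assms(2) by (intro sum_mono2) auto
  \<comment> \<open>Nonnegativity of g makes an inequality available here without proving that
    \<Phi> is injective.\<close>
  also have "\<dots> \<le> (\<Sum>h\<in>PiE ?A (\<lambda>_. {..?N}). g (\<Phi> h))"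
    using sum_image_le[OF fin, of g \<Phi>] pos assms(2) by (simp add: o_def)
  also have "\<dots> = (\<Sum>h\<in>PiE ?A (\<lambda>_. {..?N}). \<Prod>p\<in>?A. g (p ^ h p))"
    unfolding \<Phi>_def using assms(1)
    by (intro sum.cong refl multiplicative_prod_prime_powers) (auto dest: primes_le_prime)
  also have "\<dots> = (\<Prod>p\<in>?A. \<Sum>k\<le>?N. g (p ^ k))"
    by (rule prod_sum_PiE[symmetric]) auto
  finally show ?thesis .
qed

text \<open>With r the contribution of the exponents from 2 on, each Euler factor obeys 1 + g p + r
  p <= (1 + g p) (1 + r p) <= (1 + g p) exp (r p). The r p add up to a finite part of the convergent
  double series, hence to at most K.\<close>

lemma sum_multiplicative_le_exp_prod:
  assumes "multiplicative g" "\<And>n. n > 0 \<Longrightarrow> g n \<ge> 0"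
    and summable: "(\<lambda>(p, k). g (p ^ k)) summable_on {(p, k). prime p \<and> k \<ge> 2}"
    and K: "(\<Sum>\<^sub>\<infinity>(p, k)\<in>{(p, k). prime p \<and> k \<ge> 2}. g (p ^ k)) \<le> K"
  shows "(\<Sum>n\<in>{n. 0 < n \<and> real n \<le> x}. g n) \<le> exp K * (\<Prod>p\<in>primes_le x. 1 + g p)"
proof -
  let ?A = "primes_le x" and ?N = "nat \<lfloor>x\<rfloor>"
  define r where "r p = (\<Sum>k\<in>{2..?N}. g (p ^ k))" for p
  have g0: "g (p ^ k) \<ge> 0" if "prime p" for p k
    using that assms(2)[of "p ^ k"] prime_gt_0_nat[of p] by simp
  have r0: "r p \<ge> 0" if "prime p" for p
    unfolding r_def using that g0 by (intro sum_nonneg) auto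
  have "(\<Sum>n\<in>{n. 0 < n \<and> real n \<le> x}. g n) \<le> (\<Prod>p\<in>?A. \<Sum>k\<le>?N. g (p ^ k))"
    using assms by (intro sum_multiplicative_le_Euler_prod)
  also have "\<dots> \<le> (\<Prod>p\<in>?A. (1 + g p) * exp (r p))"
  proof (rule prod_mono, rule conjI)
    fix p assume "p \<in> ?A"
    hence p: "prime p" by (rule primes_le_prime)
    show "(\<Sum>k\<le>?N. g (p ^ k)) \<ge> 0" using p g0 by (intro sum_nonneg) auto
    have "(\<Sum>k\<le>?N. g (p ^ k)) \<le> (\<Sum>k\<in>{0, 1} \<union> {2..?N}. g (p ^ k))"
      using p g0 by (intro sum_mono2) auto
    also have "\<dots> = 1 + g p + r p"
      using assms(1) unfolding r_def multiplicative_def by (subst sum.union_disjoint) auto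
    also have "\<dots> \<le> (1 + g p) * (1 + r p)"
      using g0[OF p, of 1] r0[OF p] by (simp add: algebra_simps)
    also have "\<dots> \<le> (1 + g p) * exp (r p)"
      using g0[OF p, of 1] exp_ge_add_one_self[of "r p"] by (intro mult_left_mono) auto
    finally show "(\<Sum>k\<le>?N. g (p ^ k)) \<le> (1 + g p) * exp (r p)" .
  qed
  also have "\<dots> = exp (\<Sum>p\<in>?A. r p) * (\<Prod>p\<in>?A. 1 + g p)"
    by (simp add: prod.distrib exp_sum mult.commute)
  also have "\<dots> \<le> exp K * (\<Prod>p\<in>?A. 1 + g p)"
  proof (intro mult_right_mono)
    have "(\<Sum>p\<in>?A. r p) = (\<Sum>(p, k)\<in>?A \<times> {2..?N}. g (p ^ k))"
      by (simp add: r_def sum.cartesian_product)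
    also have "\<dots> \<le> (\<Sum>\<^sub>\<infinity>(p, k)\<in>{(p, k). prime p \<and> k \<ge> 2}. g (p ^ k))"
      using g0 by (intro finite_sum_le_infsum summable) (auto dest: primes_le_prime)
    finally show "exp (\<Sum>p\<in>?A. r p) \<le> exp K" using K by simp
    have "1 + g p \<ge> 0" if "p \<in> ?A" for p
      using g0[OF primes_le_prime[OF that], of 1] by simp
    thus "(\<Prod>p\<in>?A. 1 + g p) \<ge> 0" by (intro prod_nonneg) auto
  qed
  finally show ?thesis .
qed

text \<open>Weighting each squarefree \<open>z\<close>-smooth \<open>n\<close> by \<open>ln n / ln x\<close> bounds the contribution of
  \<open>n > x\<close> to the expanded product, in place of Rankin's trick.\<close>

lemma sum_multiplicative_ge_half_prod:
  assumes "multiplicative g" "\<And>n. n > 0 \<Longrightarrow> g n \<ge> 0" "x > 1"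
    and "(\<Sum>p\<in>primes_le z. g p * ln (real p)) \<le> ln x / 2"
  shows "(\<Sum>n\<in>{n. 0 < n \<and> real n \<le> x}. g n) \<ge> (\<Prod>p\<in>primes_le z. 1 + g p) / 2"
proof -
  let ?A = "primes_le z"
  let ?P = "\<Prod>p\<in>?A. 1 + g p" and ?l = "\<lambda>p::nat. ln (real p)"
  have g0: "g p \<ge> 0" if "prime p" for p
    using that assms(2)[of p] prime_gt_0_nat[of p] by simp
  have sub: "finite T" "\<And>p. p \<in> T \<Longrightarrow> prime p" if "T \<in> Pow ?A" for T
    using that by (auto intro: finite_subset dest: primes_le_prime)
  have pos: "\<Prod>T > 0" if "T \<in> Pow ?A" for T
    using sub[OF that] by (intro prod_pos) (auto dest: prime_gt_0_nat)
  have gT: "g (\<Prod>T) = prod g T" if "T \<in> Pow ?A" for T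
    using multiplicative_prod_prime_powers[OF assms(1) sub[OF that], of "\<lambda>_. 1"] by simp
  have pf: "prime_factors (\<Prod>T) = T" if "T \<in> Pow ?A" for T
    using sub[OF that] sub(2)[OF that, of 0] by (subst prime_factors_prod) (auto simp: prime_prime_factors)
  have P0: "?P \<ge> 0" by (intro prod_nonneg) (auto simp: g0 primes_le_prime add_nonneg_nonneg)
  have P: "?P = (\<Sum>T\<in>Pow ?A. prod g T)"
    using prod_add[OF finite_primes_le, of g "\<lambda>_. 1"] by (simp add: add.commute)
  have lT: "ln (real (\<Prod>T)) = sum ?l T" if "T \<in> Pow ?A" for T
    unfolding of_nat_prod using sub(1)[OF that] sub(2)[OF that, of 0] by (intro ln_prod) (auto intro!: Nat.gr0I)
  let ?S = "{T \<in> Pow ?A. real (\<Prod>T) \<le> x}"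
  \<comment> \<open>This is Markov's inequality: a set T whose product exceeds x has total logarithm
    at least ln x, so the first moment of the logarithm controls the weight of all such T.\<close>
  have "(\<Sum>T\<in>Pow ?A - ?S. prod g T) * ln x = (\<Sum>T\<in>Pow ?A - ?S. prod g T * ln x)"
    by (rule sum_distrib_right)
  also have "\<dots> \<le> (\<Sum>T\<in>Pow ?A - ?S. prod g T * sum ?l T)"
  proof (intro sum_mono mult_left_mono)
    fix T assume T: "T \<in> Pow ?A - ?S"
    thus "prod g T \<ge> 0" using sub g0 by (intro prod_nonneg) auto
    have "ln x \<le> ln (real (\<Prod>T))" using T assms(3) by (subst ln_le_cancel_iff) auto
    thus "ln x \<le> sum ?l T" using T lT by simp
  qed
  also have "\<dots> \<le> (\<Sum>T\<in>Pow ?A. prod g T * sum ?l T)"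
  proof (rule sum_mono2)
    fix T assume "T \<in> Pow ?A - (Pow ?A - ?S)"
    hence "prime p" if "p \<in> T" for p using sub(2)[of T p] that by blast
    thus "0 \<le> prod g T * sum ?l T"
      using g0 by (intro mult_nonneg_nonneg prod_nonneg sum_nonneg)
                  (auto simp: Suc_le_eq prime_gt_0_nat)
  qed auto
  also have "\<dots> \<le> (\<Sum>p\<in>?A. g p * ?l p) * ?P"
    using g0 by (intro sum_Pow_weighted_le) (auto dest: primes_le_prime simp: Suc_le_eq prime_gt_0_nat)
  also have "\<dots> \<le> ln x / 2 * ?P" using assms(4) P0 by (intro mult_right_mono)
  finally have "(\<Sum>T\<in>Pow ?A - ?S. prod g T) \<le> ?P / 2"
    using assms(3) by (simp add: field_simps)
  moreover have "?P = (\<Sum>T\<in>Pow ?A - ?S. prod g T) + (\<Sum>T\<in>?S. prod g T)"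
    unfolding P by (rule sum.subset_diff) auto
  ultimately have "?P / 2 \<le> (\<Sum>T\<in>?S. prod g T)" by simp
  also have "\<dots> = (\<Sum>T\<in>?S. g (\<Prod>T))" by (intro sum.cong) (auto simp: gT)
  also have "\<dots> = sum g ((\<lambda>T. \<Prod>T) ` ?S)"
  proof -
    \<comment> \<open>Unique factorisation recovers T as the set of prime factors of its
      product.\<close>
    have "inj_on (\<lambda>T. \<Prod>T) ?S"
      by (rule inj_on_inverseI[of _ prime_factors]) (use pf in blast)
    thus ?thesis by (simp add: sum.reindex o_def)
  qed
  also have "\<dots> \<le> (\<Sum>n\<in>{n. 0 < n \<and> real n \<le> x}. g n)"
    using pos assms(2) by (intro sum_mono2) auto
  finally show ?thesis .
qed

text \<open>The factors at primes between z and x are at most exp (B / p), and the sum of 1 / p over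
  that range is already bounded.\<close>

lemma prod_primes_le_le:
  assumes "\<And>p. prime p \<Longrightarrow> 0 \<le> f p \<and> f p \<le> B" "1 < z" "z \<le> x"
  shows "(\<Prod>p\<in>primes_le x. 1 + f p / real p)
       \<le> exp (2 * B * ln x / ln z) * (\<Prod>p\<in>primes_le z. 1 + f p / real p)"
proof -
  let ?D = "primes_le x - primes_le z"
  have B: "B \<ge> 0" using assms(1)[of 2] by simp
  have "(\<Prod>p\<in>primes_le x. 1 + f p / real p) = (\<Prod>p\<in>?D. 1 + f p / real p) * (\<Prod>p\<in>primes_le z. 1 + f p / real p)"
    using assms by (intro prod.subset_diff) (auto simp: primes_le_def)
  also have "\<dots> \<le> exp (2 * B * ln x / ln z) * (\<Prod>p\<in>primes_le z. 1 + f p / real p)"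
  proof (rule mult_right_mono)
    have "(\<Prod>p\<in>?D. 1 + f p / real p) \<le> (\<Prod>p\<in>?D. exp (B * (1 / real p)))"
    proof (rule prod_mono, rule conjI)
      fix p assume "p \<in> ?D"
      hence p: "prime p" by (auto dest: primes_le_prime)
      show "0 \<le> 1 + f p / real p" using assms(1)[OF p] by simp
      have "1 + f p / real p \<le> 1 + B * (1 / real p)"
        using assms(1)[OF p] by (simp add: divide_right_mono)
      also have "\<dots> \<le> exp (B * (1 / real p))" by (rule exp_ge_add_one_self)
      finally show "1 + f p / real p \<le> exp (B * (1 / real p))" .
    qed
    also have "\<dots> = exp (B * (\<Sum>p\<in>?D. 1 / real p))"
      by (simp add: exp_sum sum_distrib_left)
    also have "\<dots> \<le> exp (B * (2 * ln x / ln z))"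
      unfolding exp_le_cancel_iff
      using B sum_inverse_primes_between[OF assms(2,3)] by (intro mult_left_mono)
    finally show "(\<Prod>p\<in>?D. 1 + f p / real p) \<le> exp (2 * B * ln x / ln z)" by (simp add: mult_ac)
    show "0 \<le> (\<Prod>p\<in>primes_le z. 1 + f p / real p)"
      using assms(1) by (intro prod_nonneg) (auto dest: primes_le_prime)
  qed
  finally show ?thesis .
qed

lemma sum_multiplicative_ge_prod:
  assumes "multiplicative f" "\<And>n. n > 0 \<Longrightarrow> f n \<ge> 0" "\<And>p. prime p \<Longrightarrow> f p \<le> B" "x > 1"
  shows "(\<Sum>n\<in>{n. 0 < n \<and> real n \<le> x}. f n / real n)
      \<ge> exp (- 2 * B * (4 * B + 1)) / 2 * (\<Prod>p\<in>primes_le x. 1 + f p / real p)"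
proof -
  have f0: "f p \<ge> 0" if "prime p" for p
    using that assms(2)[of p] prime_gt_0_nat[of p] by simp
  have B: "B \<ge> 0" using assms(3)[of 2] f0[of 2] by simp
  \<comment> \<open>The Mertens bound 2 B ln z then equals 2 B / (4 B + 1) times ln x, which is at
    most half of ln x. The summand 1 keeps z <= x and admits B = 0.\<close>
  define z where "z = x powr (1 / (4 * B + 1))"
  have lnz: "ln z = ln x / (4 * B + 1)" using assms(4) by (simp add: z_def ln_powr)
  have z: "z > 1" "z \<le> x"
  proof -
    show "z > 1" using assms(4) B by (simp add: z_def)
    have "z \<le> x powr 1" unfolding z_def using assms(4) B by (intro powr_mono) auto
    thus "z \<le> x" using assms(4) by simp
  qed
  have "(\<Sum>p\<in>primes_le z. f p / real p * ln (real p)) \<le> (\<Sum>p\<in>primes_le z. B * (ln (real p) / real p))"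
  proof (intro sum_mono)
    fix p assume "p \<in> primes_le z"
    hence p: "prime p" by (rule primes_le_prime)
    have "f p * (ln (real p) / real p) \<le> B * (ln (real p) / real p)"
      using assms(3)[OF p] prime_gt_0_nat[OF p] by (intro mult_right_mono) auto
    thus "f p / real p * ln (real p) \<le> B * (ln (real p) / real p)" by simp
  qed
  also have "\<dots> \<le> B * (2 * ln z)"
    unfolding sum_distrib_left[symmetric] using sum_ln_div_primes_le[of z] z B
    by (intro mult_left_mono) auto
  also have "\<dots> \<le> ln x / 2"
    using assms(4) B by (simp add: lnz field_simps)
  finally have "(\<Prod>p\<in>primes_le z. 1 + f p / real p) / 2 \<le> (\<Sum>n\<in>{n. 0 < n \<and> real n \<le> x}. f n / real n)"
    using assms by (intro sum_multiplicative_ge_half_prod multiplicative_div_id) auto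
  moreover have "(\<Prod>p\<in>primes_le x. 1 + f p / real p)
      \<le> exp (2 * B * (4 * B + 1)) * (\<Prod>p\<in>primes_le z. 1 + f p / real p)"
  proof -
    have "2 * B * ln x / ln z = 2 * B * (4 * B + 1)"
      using assms(4) by (simp add: lnz)
    thus ?thesis using prod_primes_le_le[of f B z x] f0 assms(3) z by simp
  qed
  hence "exp (- (2 * B * (4 * B + 1))) * (\<Prod>p\<in>primes_le x. 1 + f p / real p)
      \<le> (\<Prod>p\<in>primes_le z. 1 + f p / real p)"
    unfolding exp_minus by (simp add: field_simps)
  ultimately show ?thesis by simp
qed

subsection \<open>Averages of multiplicative functions\<close>

lemma sum_ln_prime_divisors_le:
  assumes "n > 0"
  shows "(\<Sum>p | prime p \<and> p dvd n. ln (real p)) \<le> ln (real n)"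
proof -
  have "(\<Sum>p | prime p \<and> p dvd n. ln (real p)) = (\<Sum>p | prime p \<and> p dvd n. mangoldt p)"
    by (intro sum.cong) auto
  also have "\<dots> \<le> (\<Sum>d | d dvd n. mangoldt d)"
    using assms by (intro sum_mono2) (auto simp: mangoldt_nonneg)
  also have "\<dots> = ln (real n)"
    using mangoldt_sum[of n, where ?'a = real] assms by simp
  finally show ?thesis .
qed

text \<open>The sum of f n ln p over pairs with p dividing n is counted in two ways. For fixed n the
  logarithms add up to at most ln n <= ln x; writing n = m p with p not dividing m makes f split as
  f m f p.\<close>

lemma ln_mult_sum_multiplicative_ge:
  assumes "multiplicative f" "\<And>n. n > 0 \<Longrightarrow> f n \<ge> 0" "x > 1"
  shows "ln x * (\<Sum>n\<in>{n. 0 < n \<and> real n \<le> x}. f n)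
     \<ge> (\<Sum>m\<in>{m. 0 < m \<and> real m \<le> x}. f m * (\<Sum>p\<in>{p \<in> primes_le (x / real m). \<not> p dvd m}. f p * ln (real p)))"
proof -
  let ?X = "{n::nat. 0 < n \<and> real n \<le> x}"
  let ?Q = "\<lambda>m. {p \<in> primes_le (x / real m). \<not> p dvd m}"
  let ?D = "\<lambda>n. {p. prime p \<and> p dvd n}"
  let ?F = "\<lambda>(n::nat, p::nat). f n * ln (real p)"
  have finD: "finite (?D n)" if "n \<in> ?X" for n
    using that by (intro finite_subset[OF _ finite_divisors_nat[of n]]) auto
  have "(\<Sum>m\<in>?X. f m * (\<Sum>p\<in>?Q m. f p * ln (real p)))
      = (\<Sum>m\<in>?X. \<Sum>p\<in>?Q m. f (m * p) * ln (real p))"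
  proof (intro sum.cong refl)
    fix m assume m: "m \<in> ?X"
    have "f (m * p) = f m * f p" if "p \<in> ?Q m" for p
    proof -
      have "coprime m p" using that prime_imp_coprime[of p m] 
        by (auto simp: primes_le_def coprime_commute)
      moreover have "p > 0" using that by (auto dest: primes_le_prime prime_gt_0_nat)
      ultimately show ?thesis using assms(1) m unfolding multiplicative_def by auto
    qed
    thus "f m * (\<Sum>p\<in>?Q m. f p * ln (real p)) = (\<Sum>p\<in>?Q m. f (m * p) * ln (real p))"
      by (simp add: sum_distrib_left mult_ac)
  qed
  also have "\<dots> = (\<Sum>(m, p)\<in>Sigma ?X ?Q. ?F (m * p, p))"
    by (subst sum.Sigma) auto
  also have "\<dots> = sum ?F ((\<lambda>(m, p). (m * p, p)) ` Sigma ?X ?Q)"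
    by (subst sum.reindex)
       (auto simp: inj_on_def case_prod_unfold dest!: primes_le_prime prime_gt_0_nat)
  \<comment> \<open>Carrying p along made the reindexing injective. The pairs not hit are those
    where p^2 divides n, and they contribute nonnegative amounts.\<close>
  also have "\<dots> \<le> sum ?F (Sigma ?X ?D)"
  proof (rule sum_mono2)
    show "finite (Sigma ?X ?D)" using finD by (intro finite_SigmaI) auto
    show "(\<lambda>(m, p). (m * p, p)) ` Sigma ?X ?Q \<subseteq> Sigma ?X ?D"
      by (auto simp: primes_le_def field_simps prime_gt_0_nat)
    show "?F np \<ge> 0" if "np \<in> Sigma ?X ?D - (\<lambda>(m, p). (m * p, p)) ` Sigma ?X ?Q" for np
      using that assms(2) by (auto dest!: prime_gt_0_nat simp: Suc_le_eq)
  qed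
  also have "\<dots> = (\<Sum>n\<in>?X. f n * (\<Sum>p\<in>?D n. ln (real p)))"
    using finD by (subst sum.Sigma[symmetric]) (auto simp: sum_distrib_left)
  also have "\<dots> \<le> (\<Sum>n\<in>?X. f n * ln x)"
  proof (intro sum_mono mult_left_mono)
    fix n assume n: "n \<in> ?X"
    have "(\<Sum>p\<in>?D n. ln (real p)) \<le> ln (real n)" using n by (intro sum_ln_prime_divisors_le) auto
    also have "\<dots> \<le> ln x" using n assms(3) by simp
    finally show "(\<Sum>p\<in>?D n. ln (real p)) \<le> ln x" .
  qed (use assms(2) in auto)
  also have "\<dots> = ln x * (\<Sum>n\<in>?X. f n)" by (simp add: sum_distrib_left mult.commute)
  finally show ?thesis .
qed

section \<open>Sparseness of S and primes outside it\<close>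

lemma primorial_in_pos: "primorial_in S x > 0"
  unfolding primorial_in_def by (intro prod_pos) (auto dest: prime_gt_0_nat)

lemma ln_primorial_in:
  "ln (real (primorial_in S x)) = (\<Sum>p\<in>S \<inter> primes_le x. ln (real p))"
proof -
  have "{p. p \<in> S \<and> prime p \<and> real p \<le> x} = S \<inter> primes_le x"
    by (auto simp: primes_le_def)
  thus ?thesis
    unfolding primorial_in_def of_nat_prod
    by (auto intro!: ln_prod dest!: primes_le_prime)
qed

text \<open>A union bound: the discarded primes divide m, at total cost ln m, or lie in S up to y <=
  x, at total cost the logarithm of the primorial.\<close>

lemma sum_ln_primes_avoiding_ge:
  assumes "0 < m" "y \<le> x"
  shows "(\<Sum>p\<in>{p \<in> primes_le y. \<not> p dvd m \<and> p \<notin> S}. ln (real p))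
      \<ge> (\<Sum>p\<in>primes_le y. ln (real p)) - ln (real m) - ln (real (primorial_in S x))"
proof -
  have fin: "finite {p. prime p \<and> p dvd m}"
    using assms by (intro finite_subset[OF _ finite_divisors_nat[of m]]) auto
  let ?G = "{p \<in> primes_le y. \<not> p dvd m \<and> p \<notin> S}"
  have l0: "ln (real p) \<ge> 0" if "prime p" for p
    using prime_gt_0_nat[OF that] by (simp add: Suc_le_eq)
  have "(\<Sum>p\<in>primes_le y. ln (real p)) \<le> (\<Sum>p\<in>?G \<union> ({p. prime p \<and> p dvd m} \<union> S \<inter> primes_le x). ln (real p))"
    using assms fin l0 by (intro sum_mono2) (auto simp: primes_le_def)
  also have "\<dots> \<le> (\<Sum>p\<in>?G. ln (real p)) + (\<Sum>p\<in>{p. prime p \<and> p dvd m} \<union> S \<inter> primes_le x. ln (real p))"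
    using fin l0 by (subst sum.union_inter[symmetric]) (auto intro!: sum_nonneg dest: primes_le_prime)
  also have "(\<Sum>p\<in>{p. prime p \<and> p dvd m} \<union> S \<inter> primes_le x. ln (real p))
      \<le> (\<Sum>p | prime p \<and> p dvd m. ln (real p)) + (\<Sum>p\<in>S \<inter> primes_le x. ln (real p))"
    using fin l0 by (subst sum.union_inter[symmetric]) (auto intro!: sum_nonneg dest: primes_le_prime)
  also have "(\<Sum>p | prime p \<and> p dvd m. ln (real p)) \<le> ln (real m)"
    using assms by (intro sum_ln_prime_divisors_le)
  finally show ?thesis by (simp add: ln_primorial_in)
qed

lemma eventually_primorial_in_le:
  assumes "(\<lambda>x::real. real (primorial_in S x)) \<in> O[at_top](\<lambda>x. x powr 1)"
  obtains C where "C > 0" "\<forall>\<^sub>F x in at_top. ln (real (primorial_in S x)) \<le> ln C + ln x"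
proof -
  from assms obtain C where C: "C > 0"
    "\<forall>\<^sub>F x in at_top. norm (real (primorial_in S x)) \<le> C * norm (x powr 1)"
    by (elim landau_o.bigE)
  have "\<forall>\<^sub>F x in at_top. ln (real (primorial_in S x)) \<le> ln C + ln x"
    using C(2) eventually_gt_at_top[of 0]
  proof eventually_elim
    case (elim x)
    hence "real (primorial_in S x) \<le> C * x" by simp
    hence "ln (real (primorial_in S x)) \<le> ln (C * x)"
      using primorial_in_pos[of S x] C(1) elim by (subst ln_le_cancel_iff) auto
    thus ?case using C(1) elim by (simp add: ln_mult)
  qed
  with C(1) that show ?thesis by blast
qed

text \<open>If S contained every prime, the logarithm of its primorial would be at least x / 2 by
  Chebyshev, against the logarithmic bound. Such a prime later yields \<delta> \<le> B.\<close>

lemma ex_prime_notin_sparse: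
  assumes "C > 0" "\<forall>\<^sub>F x in at_top. ln (real (primorial_in S x)) \<le> ln C + ln x"
  shows "\<exists>p. prime p \<and> p \<notin> S"
proof (rule ccontr)
  assume "\<not> ?thesis"
  hence "S \<inter> primes_le x = primes_le x" for x by (auto simp: primes_le_def)
  hence theta: "ln (real (primorial_in S x)) = (\<Sum>p\<in>primes_le x. ln (real p))" for x
    by (simp add: ln_primorial_in)
  have "\<forall>\<^sub>F x::real in at_top. ln C + ln x < x / 2" by real_asymp
  with assms(2) eventually_sum_ln_primes_ge have "\<forall>\<^sub>F x::real in at_top. False"
    by eventually_elim (use theta in force)
  thus False by simp
qed

text \<open>The truncation \<open>m \<le> sqrt x\<close> keeps \<open>x / m \<ge> sqrt x\<close>, so the primes dividing \<open>m\<close> or lying in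
  \<open>S\<close>, whose logarithms sum to \<open>O(ln x)\<close>, are negligible among the primes up to \<open>x / m\<close>.\<close>

lemma eventually_sum_multiplicative_ge:
  assumes f: "multiplicative f" "\<And>n. n > 0 \<Longrightarrow> f n \<ge> 0"
    and \<delta>: "\<delta> > 0" "\<And>p. prime p \<Longrightarrow> p \<notin> S \<Longrightarrow> \<delta> \<le> f p"
    and C: "C > 0" "\<forall>\<^sub>F x in at_top. ln (real (primorial_in S x)) \<le> ln C + ln x"
  shows "\<forall>\<^sub>F x in at_top. (\<Sum>n\<in>{n. 0 < n \<and> real n \<le> x}. f n)
     \<ge> \<delta> / 4 * (x / ln x) * (\<Sum>n\<in>{n. 0 < n \<and> real n \<le> sqrt x}. f n / real n)"
proof -
  obtain y0 where y0: "\<And>y. y \<ge> y0 \<Longrightarrow> (\<Sum>p\<in>primes_le y. ln (real p)) \<ge> y / 2"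
    using eventually_sum_ln_primes_ge by (auto simp: eventually_at_top_linorder)
  have "\<forall>\<^sub>F x in at_top. sqrt x \<ge> y0" by real_asymp
  moreover have "\<forall>\<^sub>F x::real in at_top. sqrt x / 4 \<ge> ln C + 2 * ln x" by real_asymp
  ultimately show ?thesis using C(2) eventually_gt_at_top[of 1]
  proof eventually_elim
    case (elim x)
    let ?Q = "\<lambda>m. {p \<in> primes_le (x / real m). \<not> p dvd m}"
    let ?M = "\<lambda>y. {n. 0 < n \<and> real n \<le> y}"
    have f0: "f p \<ge> 0" "ln (real p) \<ge> 0" if "prime p" for p
      using that f(2)[of p] prime_gt_0_nat[of p] by (auto simp: Suc_le_eq)
    have sx: "sqrt x \<le> x" "sqrt x > 1"
      using elim real_sqrt_le_mono[of 1 x] sqrt_le_D[of x x]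
      by (auto intro!: real_le_lsqrt simp: power2_eq_square)
    have inner: "(\<Sum>p\<in>?Q m. f p * ln (real p)) \<ge> \<delta> * (x / (4 * real m))" if m: "m \<in> ?M (sqrt x)" for m
    proof -
      have m1: "real m \<ge> 1" "real m \<le> sqrt x" using m by auto
      have "real m * sqrt x \<le> sqrt x * sqrt x" using m1 elim by (intro mult_right_mono) auto
      hence xm: "x / real m \<ge> sqrt x" using m1 elim by (simp add: field_simps)
      have xm': "x / real m \<le> x" using m1 elim by (simp add: field_simps)
      \<comment> \<open>Half of the Chebyshev bound x / (2 m) is set aside. It is at least sqrt x /
        4, which absorbs ln m and the logarithm of the primorial, together at most ln C + 2 ln
        x.\<close>
      have "x / (4 * real m) \<le> x / real m / 2 - sqrt x / 4"
        using xm by simp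
      also have "\<dots> \<le> x / real m / 2 - ln (real m) - ln (real (primorial_in S x))"
      proof -
        have "ln (real m) \<le> ln x" using m1 sx elim by simp
        thus ?thesis using elim by linarith
      qed
      also have "\<dots> \<le> (\<Sum>p\<in>primes_le (x / real m). ln (real p)) - ln (real m) - ln (real (primorial_in S x))"
        using y0[of "x / real m"] xm elim by simp
      also have "\<dots> \<le> (\<Sum>p\<in>{p \<in> primes_le (x / real m). \<not> p dvd m \<and> p \<notin> S}. ln (real p))"
        using m xm' by (intro sum_ln_primes_avoiding_ge) auto
      finally have "\<delta> * (x / (4 * real m)) \<le> \<delta> * \<dots>" using \<delta> by (intro mult_left_mono) auto
      also have "\<dots> \<le> (\<Sum>p\<in>{p \<in> primes_le (x / real m). \<not> p dvd m \<and> p \<notin> S}. f p * ln (real p))"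
        unfolding sum_distrib_left using \<delta> f0
        by (intro sum_mono mult_right_mono) (auto dest: primes_le_prime)
      also have "\<dots> \<le> (\<Sum>p\<in>?Q m. f p * ln (real p))"
        using f0 by (intro sum_mono2) (auto dest: primes_le_prime)
      finally show ?thesis .
    qed
    have "\<delta> * x / 4 * (\<Sum>m\<in>?M (sqrt x). f m / real m) = (\<Sum>m\<in>?M (sqrt x). f m * (\<delta> * (x / (4 * real m))))"
      by (simp add: sum_distrib_left field_simps)
    also have "\<dots> \<le> (\<Sum>m\<in>?M (sqrt x). f m * (\<Sum>p\<in>?Q m. f p * ln (real p)))"
      using f(2) inner by (intro sum_mono mult_left_mono) auto
    also have "\<dots> \<le> (\<Sum>m\<in>?M x. f m * (\<Sum>p\<in>?Q m. f p * ln (real p)))"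
    proof (rule sum_mono2)
      show "?M (sqrt x) \<subseteq> ?M x" using sx by auto
      fix m assume "m \<in> ?M x - ?M (sqrt x)"
      thus "0 \<le> f m * (\<Sum>p\<in>?Q m. f p * ln (real p))"
        using f(2) f0 by (intro mult_nonneg_nonneg sum_nonneg) (auto dest: primes_le_prime)
    qed simp
    also have "\<dots> \<le> ln x * (\<Sum>n\<in>?M x. f n)"
      using f elim by (intro ln_mult_sum_multiplicative_ge) auto
    finally show ?case using elim by (simp add: field_simps)
  qed
qed

text \<open>The constant collects one factor per comparison: c from bounding M below by the Euler
  product, exp (- 4 B) from moving that product from sqrt x to x, exp (- K) from bounding M above by
  it, and 1 / 4 from the Chebyshev step.\<close>

lemma eventually_sums_ge:
  fixes f :: "nat \<Rightarrow> real"
  assumes f: "multiplicative f" "\<And>n. n > 0 \<Longrightarrow> f n \<ge> 0"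
    and S: "(\<lambda>x::real. real (primorial_in S x)) \<in> O[at_top](\<lambda>x. x powr 1)"
    and \<delta>: "\<delta> > 0" "\<And>p. prime p \<Longrightarrow> p \<notin> S \<Longrightarrow> \<delta> \<le> f p \<and> f p \<le> B" "\<And>p. p \<in> S \<Longrightarrow> f p \<le> \<delta>"
    and summable: "(\<lambda>(p, k). f (p ^ k) / real (p ^ k)) summable_on {(p, k). prime p \<and> k \<ge> 2}"
    and K: "(\<Sum>\<^sub>\<infinity>(p, k)\<in>{(p, k). prime p \<and> k \<ge> 2}. f (p ^ k) / real (p ^ k)) \<le> K"
  defines "c \<equiv> exp (- 2 * B * (4 * B + 1)) / 2"
  shows "\<forall>\<^sub>F x in at_top.
      (\<Sum>n\<in>{n. 0 < n \<and> real n \<le> x}. f n)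
        \<ge> c * exp (- 4 * B) * exp (- K) / 4 * (\<delta> * (x / ln x) * (\<Sum>n\<in>{n. 0 < n \<and> real n \<le> x}. f n / real n))
    \<and> (\<Sum>n\<in>{n. 0 < n \<and> real n \<le> x}. f n / real n) \<ge> c * (\<Prod>p\<in>primes_le x. 1 + f p / real p)"
proof -
  obtain C where C: "C > 0" "\<forall>\<^sub>F x in at_top. ln (real (primorial_in S x)) \<le> ln C + ln x"
    using eventually_primorial_in_le[OF S] .
  obtain q where "prime q" "q \<notin> S" using ex_prime_notin_sparse[OF C] by blast
  \<comment> \<open>Values on S are bounded only by \<delta>; comparing \<delta> with B makes B a
    uniform bound at all primes.\<close>
  hence "\<delta> \<le> B" using \<delta>(2)[of q] by simp
  hence fB: "f p \<le> B" if "prime p" for p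
    using \<delta>(2)[OF that] \<delta>(3)[of p] by force
  have f0: "f p \<ge> 0" if "prime p" for p
    using that f(2)[of p] prime_gt_0_nat[of p] by simp
  have "\<forall>\<^sub>F x in at_top. (\<Sum>n\<in>{n. 0 < n \<and> real n \<le> x}. f n)
     \<ge> \<delta> / 4 * (x / ln x) * (\<Sum>n\<in>{n. 0 < n \<and> real n \<le> sqrt x}. f n / real n)"
    using f \<delta> C by (intro eventually_sum_multiplicative_ge) auto
  thus ?thesis using eventually_gt_at_top[of 1]
  proof eventually_elim
    case (elim x)
    let ?M = "\<lambda>y. \<Sum>n\<in>{n. 0 < n \<and> real n \<le> y}. f n / real n"
    let ?P = "\<lambda>y. \<Prod>p\<in>primes_le y. 1 + f p / real p"
    have sx: "sqrt x \<le> x" "sqrt x > 1"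
      using elim by (auto intro!: real_le_lsqrt simp: power2_eq_square)
    have lower: "c * ?P y \<le> ?M y" if "y > 1" for y
      unfolding c_def using f fB that by (intro sum_multiplicative_ge_prod) auto
    have c: "c > 0" by (simp add: c_def)
    have "?M x \<le> exp K * ?P x"
      using f summable K by (intro sum_multiplicative_le_exp_prod multiplicative_div_id) auto
    also have "?P x \<le> exp (2 * B * ln x / ln (sqrt x)) * ?P (sqrt x)"
      using f0 fB sx by (intro prod_primes_le_le) auto
    also have "2 * B * ln x / ln (sqrt x) = 4 * B"
      using elim by (simp add: ln_sqrt)
    finally have "?M x \<le> exp K * (exp (4 * B) * ?P (sqrt x))" by simp
    hence "exp (- 4 * B) * exp (- K) * ?M x \<le> ?P (sqrt x)"
      by (simp add: exp_minus field_simps)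
    hence "c * (exp (- 4 * B) * exp (- K) * ?M x) \<le> c * ?P (sqrt x)"
      using c by (intro mult_left_mono) auto
    also have "\<dots> \<le> ?M (sqrt x)" using lower sx by simp
    finally have "\<delta> / 4 * (x / ln x) * (c * (exp (- 4 * B) * exp (- K) * ?M x)) \<le> \<delta> / 4 * (x / ln x) * ?M (sqrt x)"
      using \<delta> elim by (intro mult_left_mono) auto
    also have "\<dots> \<le> (\<Sum>n\<in>{n. 0 < n \<and> real n \<le> x}. f n)" by (rule elim)
    finally show ?case using lower elim by (simp add: mult_ac)
  qed
qed

text \<open>The order of quantifiers expresses uniformity: \<open>c\<^sub>1\<close> and
  \<open>c\<^sub>2\<close> depend on B and on K alone, K being the implied constant of hypothesis
  (c), while the threshold for x may depend on all the data.\<close>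

theorem theorem2p4:
  fixes B K :: real
  assumes "B > 0"
  shows "\<exists>c\<^sub>1>0. \<exists>c\<^sub>2>0. \<forall>(lam :: nat \<Rightarrow> real) (S :: nat set) (\<delta> :: real).
    multiplicative lam \<and> (\<forall>n>0. lam n \<ge> 0) \<and>
    (\<forall>p\<in>S. prime p) \<and>
    (\<forall>\<alpha>>0. (\<lambda>x::real. real (primorial_in S x)) \<in> O[at_top](\<lambda>x. x powr \<alpha>)) \<and>
    \<delta> > 0 \<and>
    (\<forall>p. prime p \<and> p \<notin> S \<longrightarrow> \<delta> \<le> lam p \<and> lam p \<le> B) \<and>
    (\<forall>p\<in>S. lam p \<le> \<delta>) \<and>
    (\<lambda>(p, k). lam (p ^ k) / real (p ^ k)) summable_on {(p, k). prime p \<and> k \<ge> 2} \<and>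
    (\<Sum>\<^sub>\<infinity>(p, k)\<in>{(p, k). prime p \<and> k \<ge> 2}. lam (p ^ k) / real (p ^ k)) \<le> K
    \<longrightarrow>
    (\<forall>\<^sub>F x::real in at_top.
      (\<Sum>n\<in>{n. 0 < n \<and> real n \<le> x}. lam n)
        \<ge> c\<^sub>1 * (\<delta> * (real (totient (primorial_in S x)) / real (primorial_in S x)) * (x / ln x)
                * (\<Sum>n\<in>{n. 0 < n \<and> real n \<le> x}. lam n / real n)) \<and>
      \<delta> * (real (totient (primorial_in S x)) / real (primorial_in S x)) * (x / ln x)
          * (\<Sum>n\<in>{n. 0 < n \<and> real n \<le> x}. lam n / real n)
        \<ge> c\<^sub>2 * (\<delta> * (real (totient (primorial_in S x)) / real (primorial_in S x)) * (x / ln x)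
                * (\<Prod>p\<in>{p. prime p \<and> real p \<le> x}. 1 + lam p / real p)))"
proof -
  define c where "c = exp (- 2 * B * (4 * B + 1)) / 2"
  define c' where "c' = c * exp (- 4 * B) * exp (- K) / 4"
  have c: "c > 0" "c' > 0" by (auto simp: c_def c'_def)
  show ?thesis
  proof (rule exI[of _ c'], rule conjI[OF c(2)], rule exI[of _ c], rule conjI[OF c(1)],
         intro allI impI, elim conjE)
    fix lam :: "nat \<Rightarrow> real" and S :: "nat set" and \<delta> :: real
    assume lam: "multiplicative lam" "\<forall>n>0. lam n \<ge> 0"
      and S: "\<forall>\<alpha>>0. (\<lambda>x::real. real (primorial_in S x)) \<in> O[at_top](\<lambda>x. x powr \<alpha>)"
      and \<delta>: "\<delta> > 0" "\<forall>p. prime p \<and> p \<notin> S \<longrightarrow> \<delta> \<le> lam p \<and> lam p \<le> B" "\<forall>p\<in>S. lam p \<le> \<delta>"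
      and K: "(\<lambda>(p, k). lam (p ^ k) / real (p ^ k)) summable_on {(p, k). prime p \<and> k \<ge> 2}"
        "(\<Sum>\<^sub>\<infinity>(p, k)\<in>{(p, k). prime p \<and> k \<ge> 2}. lam (p ^ k) / real (p ^ k)) \<le> K"
    have "\<forall>\<^sub>F x in at_top.
        (\<Sum>n\<in>{n. 0 < n \<and> real n \<le> x}. lam n)
          \<ge> c' * (\<delta> * (x / ln x) * (\<Sum>n\<in>{n. 0 < n \<and> real n \<le> x}. lam n / real n))
      \<and> (\<Sum>n\<in>{n. 0 < n \<and> real n \<le> x}. lam n / real n) \<ge> c * (\<Prod>p\<in>primes_le x. 1 + lam p / real p)"
      unfolding c_def c'_def using lam \<delta>
      by (intro eventually_sums_ge[where S = S] S[rule_format] K) auto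
    thus "\<forall>\<^sub>F x::real in at_top.
      (\<Sum>n\<in>{n. 0 < n \<and> real n \<le> x}. lam n)
        \<ge> c' * (\<delta> * (real (totient (primorial_in S x)) / real (primorial_in S x)) * (x / ln x)
                * (\<Sum>n\<in>{n. 0 < n \<and> real n \<le> x}. lam n / real n)) \<and>
      \<delta> * (real (totient (primorial_in S x)) / real (primorial_in S x)) * (x / ln x)
          * (\<Sum>n\<in>{n. 0 < n \<and> real n \<le> x}. lam n / real n)
        \<ge> c * (\<delta> * (real (totient (primorial_in S x)) / real (primorial_in S x)) * (x / ln x)
                * (\<Prod>p\<in>{p. prime p \<and> real p \<le> x}. 1 + lam p / real p))"
      using eventually_gt_at_top[of 1]
    proof eventually_elim
      case (elim x)
      let ?\<phi> = "real (totient (primorial_in S x)) / real (primorial_in S x)"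
      let ?M = "\<Sum>n\<in>{n. 0 < n \<and> real n \<le> x}. lam n / real n"
      have \<phi>: "0 \<le> ?\<phi>" "?\<phi> \<le> 1"
        using totient_le[of "primorial_in S x"] primorial_in_pos[of S x] by auto
      have M: "?M \<ge> 0" using lam by (intro sum_nonneg) auto
      have "?\<phi> * (c' * (\<delta> * (x / ln x) * ?M)) \<le> 1 * (c' * (\<delta> * (x / ln x) * ?M))"
        using \<phi> M c \<delta> elim by (intro mult_right_mono) auto
      also have "\<dots> \<le> (\<Sum>n\<in>{n. 0 < n \<and> real n \<le> x}. lam n)" using elim by simp
      finally have 1: "c' * (\<delta> * ?\<phi> * (x / ln x) * ?M) \<le> (\<Sum>n\<in>{n. 0 < n \<and> real n \<le> x}. lam n)"
        by (simp only: mult_ac)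
      have "\<delta> * ?\<phi> * (x / ln x) * (c * (\<Prod>p\<in>primes_le x. 1 + lam p / real p)) \<le> \<delta> * ?\<phi> * (x / ln x) * ?M"
        using \<phi> \<delta> elim by (intro mult_left_mono) auto
      hence 2: "c * (\<delta> * ?\<phi> * (x / ln x) * (\<Prod>p\<in>{p. prime p \<and> real p \<le> x}. 1 + lam p / real p))
          \<le> \<delta> * ?\<phi> * (x / ln x) * ?M"
        unfolding primes_le_def by (simp only: mult_ac)
      show ?case using 1 2 by blast
    qed
  qed
qed

end
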